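(* Let $F\colon\mathcal{C}\to\mathcal{W}$ be a continuous map between ENR spaces. If $F$ admits a right inverse, i.e. a continuous map $I\colon\mathcal{W}\to\mathcal{C}$ with $F(I(w))=w$ for all $w\in\mathcal{W}$, then $$\mathrm{cx}(\mathcal{W})\le \mathrm{cx}(F)\le \mathrm{cx}(\mathcal{C}).$$
   Context: A space is an ENR (Euclidean Neighbourhood Retract) if it is a retract of some open subspace of some $\mathbb{R}^n$. All spaces are nonempty. $\mathrm{P}(\mathcal{C})$ is the space of continuous paths $[0,1]\to\mathcal{C}$ (compact-open topology). For a continuous map $F\colon\mathcal{C}\to\mathcal{W}$ of ENR spaces, a partial roadmap for $F$ is a continuous map $\rho\colon\mathcal{Q}\to \mathrm{P}(\mathcal{C})$ whose domain $\mathcal{Q}$ is an ENR subspace of $\mathcal{C}\times\mathcal{W}$, such that $\rho(c,w)(0)=c$ and $F(\rho(c,w)(1))=w$ for every $(c,w)\in\mathcal{Q}$. The complexity $\mathrm{cx}(F)$ is the minimal integer $n$ for which $\mathcal{C}\times\mathcal{W}$ can be covered by the domains of $n$ partial roadmaps for $F$. For a space $X$, $\mathrm{cx}(X):=\mathrm{cx}(\mathrm{Id}_X)$. As the definition presupposes, all complexities occurring in the claim are assumed to be defined (finite). *)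

theory Defs
  imports "HOL-Analysis.Analysis"
begin

text \<open>
  ENR spaces are subsets of Euclidean spaces satisfying the library predicate \<^const>\<open>ENR\<close>, which is
  invariant under homeomorphism. A subspace of a product of two such spaces is a subset of the
  product Euclidean space, so \<^const>\<open>ENR\<close> applies to it directly.
\<close>

text \<open>
  Points of the mapping space are functions made extensional outside \<^term>\<open>topspace X\<close>, so that
  they correspond exactly to the continuous maps from \<^term>\<open>X\<close> to \<^term>\<open>Y\<close>. Taking \<^term>\<open>K\<close> empty
  shows that the underlying set consists of all of these maps.
\<close>

definition compact_open_topology :: "'a topology \<Rightarrow> 'b topology \<Rightarrow> ('a \<Rightarrow> 'b) topology" where
  "compact_open_topology X Y =
     topology_generated_by
       {{f. f \<in> extensional (topspace X) \<and> continuous_map X Y f \<and> f ` K \<subseteq> U} | K U.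
          compactin X K \<and> openin Y U}"

definition path_space :: "'a::topological_space set \<Rightarrow> (real \<Rightarrow> 'a) topology" where
  "path_space C = compact_open_topology (top_of_set {0..1}) (top_of_set C)"

definition partial_roadmap ::
  "'a::euclidean_space set \<Rightarrow> 'b::euclidean_space set \<Rightarrow> ('a \<Rightarrow> 'b) \<Rightarrow>
   ('a \<times> 'b) set \<Rightarrow> ('a \<times> 'b \<Rightarrow> real \<Rightarrow> 'a) \<Rightarrow> bool" where
  "partial_roadmap C W F Q \<rho> \<longleftrightarrow>
     Q \<noteq> {} \<and> Q \<subseteq> C \<times> W \<and> ENR Q \<and>
     continuous_map (top_of_set Q) (path_space C) \<rho> \<and>
     (\<forall>(c, w) \<in> Q. \<rho> (c, w) 0 = c \<and> F (\<rho> (c, w) 1) = w)"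

definition roadmap_cover ::
  "'a::euclidean_space set \<Rightarrow> 'b::euclidean_space set \<Rightarrow> ('a \<Rightarrow> 'b) \<Rightarrow> nat \<Rightarrow> bool" where
  "roadmap_cover C W F n \<longleftrightarrow>
     (\<exists>Q \<rho>. (\<forall>i<n. partial_roadmap C W F (Q i) (\<rho> i)) \<and> C \<times> W = (\<Union>i<n. Q i))"

definition has_cx ::
  "'a::euclidean_space set \<Rightarrow> 'b::euclidean_space set \<Rightarrow> ('a \<Rightarrow> 'b) \<Rightarrow> bool" where
  "has_cx C W F \<longleftrightarrow> (\<exists>n. roadmap_cover C W F n)"

text \<open>The value of \<open>cx\<close> is meaningful only under \<^const>\<open>has_cx\<close>.\<close>

definition cx ::
  "'a::euclidean_space set \<Rightarrow> 'b::euclidean_space set \<Rightarrow> ('a \<Rightarrow> 'b) \<Rightarrow> nat" where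
  "cx C W F = (LEAST n. roadmap_cover C W F n)"

abbreviation has_cx_space :: "'a::euclidean_space set \<Rightarrow> bool" where
  "has_cx_space X \<equiv> has_cx X X id"

abbreviation cx_space :: "'a::euclidean_space set \<Rightarrow> nat" where
  "cx_space X \<equiv> cx X X id"

end

theory Submission
  imports Defs
begin

text \<open>
  Both inequalities transport a covering by roadmap domains along a product of continuous maps.
  Given a right inverse \<open>I\<close> of \<open>F\<close>, a roadmap \<open>\<rho>\<close> for \<open>F\<close> on \<open>Q\<close> yields the paths
  \<open>F \<circ> \<rho> (I w, w')\<close> from \<open>w\<close> to \<open>w'\<close> in \<open>W\<close>, defined on the preimage of \<open>Q\<close> under \<open>I \<times> id\<close>;
  and a roadmap \<open>\<rho>\<close> for the identity of \<open>C\<close> yields the paths \<open>\<rho> (c, I w)\<close>, which start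
  at \<open>c\<close> and end in the fibre of \<open>F\<close> over \<open>w\<close>, defined on the preimage under \<open>id \<times> I\<close>.

  The obstacle is that the preimage of an ENR under a continuous map need not be an ENR: the
  distance to the Cantor set pulls \<open>{0}\<close> back to the Cantor set. The preimage is, however, still
  locally compact, that is, closed in an open subset of the ambient ENR. On such a set the
  constructed family of paths is a homotopy between two maps that are defined on the whole ambient
  space: the projection to the start point, and a map prescribing the end point
  (the target itself in the first case, its image under \<open>I\<close> in the second). Since the space in
  which the paths run is an absolute neighbourhood retract, this homotopy extends to an open
  neighbourhood with the same formulas for the end points. An open subset of an ENR is an ENR, so
  the neighbourhood is a legitimate roadmap domain, and the number of domains has not changed.

  Roadmaps are translated into homotopies and back by the exponential law for the compact-open
  topology (\<open>continuous_map_uncurry\<close>, \<open>continuous_map_curry\<close>), the extension is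
  \<open>partial_roadmap_neighbourhood\<close>, and the transport of coverings is \<open>roadmap_cover_pullback\<close>.
\<close>

section \<open>The exponential law for the compact-open topology\<close>

text \<open>
  For \<open>\<rho> z\<close> mapping \<open>x\<close> into an open set \<open>U\<close>, local compactness provides a compact neighbourhood
  \<open>K\<close> of \<open>x\<close> that \<open>\<rho> z\<close> still maps into \<open>U\<close>; the subbasic open set of maps sending \<open>K\<close> into \<open>U\<close>
  then controls all nearby parameters at once.
\<close>

lemma continuous_map_uncurry:
  assumes \<rho>: "continuous_map Z (compact_open_topology X Y) \<rho>"
    and X: "neighbourhood_base_of (compactin X) X"
  shows "continuous_map (prod_topology X Z) Y (\<lambda>(x, z). \<rho> z x)"
proof -
  define subbasic where "subbasic K U =
    {f. f \<in> extensional (topspace X) \<and> continuous_map X Y f \<and> f ` K \<subseteq> U}" for K U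
  have topology: "compact_open_topology X Y =
      topology_generated_by {subbasic K U | K U. compactin X K \<and> openin Y U}"
    unfolding compact_open_topology_def subbasic_def ..
  have subbasic_open: "openin Z (\<rho> -` subbasic K U \<inter> topspace Z)"
    if "compactin X K" "openin Y U" for K U
    using \<rho> that unfolding topology continuous_on_generated_topo_iff by blast
  have \<rho>_ext: "\<rho> z \<in> extensional (topspace X)" and \<rho>_cont: "continuous_map X Y (\<rho> z)"
    if "z \<in> topspace Z" for z
    using \<rho> that unfolding topology continuous_on_generated_topo_iff subbasic_def by blast+
  show ?thesis
    unfolding continuous_map_def
  proof (intro conjI allI impI)
    show "(\<lambda>(x, z). \<rho> z x) \<in> topspace (prod_topology X Z) \<rightarrow> topspace Y"
      using \<rho>_cont by (auto simp: continuous_map_def Pi_iff)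
  next
    fix U assume U: "openin Y U"
    let ?S = "{p \<in> topspace (prod_topology X Z). (case p of (x, z) \<Rightarrow> \<rho> z x) \<in> U}"
    have "\<exists>N. openin (prod_topology X Z) N \<and> p \<in> N \<and> N \<subseteq> ?S" if "p \<in> ?S" for p
    proof -
      obtain x z where p: "p = (x, z)" "x \<in> topspace X" "z \<in> topspace Z" "\<rho> z x \<in> U"
        using \<open>p \<in> ?S\<close> by auto
      have "openin X {y \<in> topspace X. \<rho> z y \<in> U}"
        using \<rho>_cont[OF p(3)] U by (rule openin_continuous_map_preimage)
      then obtain V K where V: "openin X V" "compactin X K" "x \<in> V" "V \<subseteq> K"
          "K \<subseteq> {y \<in> topspace X. \<rho> z y \<in> U}"
        using X[unfolded neighbourhood_base_of, rule_format, of "{y \<in> topspace X. \<rho> z y \<in> U}" x] p(2,4)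
        by auto
      let ?N = "V \<times> (\<rho> -` subbasic K U \<inter> topspace Z)"
      have "z \<in> \<rho> -` subbasic K U"
        using \<rho>_ext[OF p(3)] \<rho>_cont[OF p(3)] V(5) by (auto simp: subbasic_def)
      then have "p \<in> ?N"
        using p V by auto
      moreover have "openin (prod_topology X Z) ?N"
        using V subbasic_open[OF V(2) U] by (simp add: openin_prod_Times_iff)
      moreover have "?N \<subseteq> ?S"
        using V by (auto simp: subbasic_def)
      ultimately show ?thesis
        by blast
    qed
    then show "openin (prod_topology X Z) ?S"
      by (subst openin_subopen) blast
  qed
qed

text \<open>
  The parameters \<open>z\<close> for which the slice \<open>K \<times> {z}\<close> is mapped into \<open>U\<close> form an open set by the tube
  lemma. Restricting to the space \<open>X\<close> selects the extensional representative of each map.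
\<close>

lemma continuous_map_curry:
  assumes h: "continuous_map (prod_topology X Z) Y h"
  shows "continuous_map Z (compact_open_topology X Y) (\<lambda>z. restrict (\<lambda>x. h (x, z)) (topspace X))"
proof -
  define subbasic where "subbasic K U =
    {f. f \<in> extensional (topspace X) \<and> continuous_map X Y f \<and> f ` K \<subseteq> U}" for K U
  have topology: "compact_open_topology X Y =
      topology_generated_by {subbasic K U | K U. compactin X K \<and> openin Y U}"
    unfolding compact_open_topology_def subbasic_def ..
  define \<rho> where "\<rho> z = restrict (\<lambda>x. h (x, z)) (topspace X)" for z
  have slice: "continuous_map X Y (\<rho> z)" if "z \<in> topspace Z" for z
  proof -
    have "continuous_map X (prod_topology X Z) (\<lambda>x. (x, z))"
      using that by (simp add: continuous_map_pairwise o_def)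
    then have "continuous_map X Y (h \<circ> (\<lambda>x. (x, z)))"
      using h by (rule continuous_map_compose)
    then show ?thesis
      by (rule continuous_map_eq) (simp add: \<rho>_def)
  qed
  have mem_subbasic: "\<rho> z \<in> subbasic K U \<longleftrightarrow> (\<forall>x\<in>K. h (x, z) \<in> U)"
    if "z \<in> topspace Z" "K \<subseteq> topspace X" for z K U
  proof -
    have "\<rho> z x = h (x, z)" if "x \<in> K" for x
      using \<open>K \<subseteq> topspace X\<close> that by (auto simp: \<rho>_def)
    moreover have "\<rho> z \<in> extensional (topspace X)"
      by (simp add: \<rho>_def)
    ultimately show ?thesis
      using slice[OF that(1)] by (simp add: subbasic_def image_subset_iff)
  qed
  have subbasic_open: "openin Z (\<rho> -` subbasic K U \<inter> topspace Z)"
    if K: "compactin X K" and U: "openin Y U" for K U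
  proof -
    have KX: "K \<subseteq> topspace X"
      using K by (rule compactin_subset_topspace)
    let ?S = "{p \<in> topspace (prod_topology X Z). h p \<in> U}"
    have S: "openin (prod_topology X Z) ?S"
      using h U by (rule openin_continuous_map_preimage)
    have "\<exists>V. openin Z V \<and> z \<in> V \<and> V \<subseteq> \<rho> -` subbasic K U \<inter> topspace Z"
      if "z \<in> \<rho> -` subbasic K U \<inter> topspace Z" for z
    proof -
      have z: "z \<in> topspace Z" "\<forall>x\<in>K. h (x, z) \<in> U"
        using that mem_subbasic[OF _ KX] by auto
      then have "K \<times> {z} \<subseteq> ?S"
        using KX by auto
      then obtain V' V where V: "openin Z V" "K \<subseteq> V'" "z \<in> V" "V' \<times> V \<subseteq> ?S"
        using tube_lemma_left[OF S K z(1)] by blast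
      have VZ: "V \<subseteq> topspace Z"
        using V(1) by (rule openin_subset)
      have "V \<subseteq> \<rho> -` subbasic K U \<inter> topspace Z"
      proof
        fix v assume v: "v \<in> V"
        then have "\<forall>x\<in>K. h (x, v) \<in> U"
          using V(2,4) by blast
        with v VZ mem_subbasic[OF _ KX, of v U] show "v \<in> \<rho> -` subbasic K U \<inter> topspace Z"
          by auto
      qed
      with V show ?thesis
        by blast
    qed
    then show ?thesis
      by (subst openin_subopen) blast
  qed
  have "continuous_map Z (compact_open_topology X Y) \<rho>"
    unfolding topology
  proof (rule continuous_on_generated_topo)
    show "openin Z (\<rho> -` S \<inter> topspace Z)"
      if "S \<in> {subbasic K U | K U. compactin X K \<and> openin Y U}" for S
      using that subbasic_open by blast
    \<comment> \<open>The empty compact set imposes no condition, so its subbasic set contains all continuous maps.\<close>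
    have "\<rho> ` topspace Z \<subseteq> subbasic {} (topspace Y)"
      using mem_subbasic[of _ "{}"] by auto
    moreover have "subbasic {} (topspace Y) \<in> {subbasic K U | K U. compactin X K \<and> openin Y U}"
      using compactin_empty openin_topspace by blast
    ultimately show "\<rho> ` topspace Z \<subseteq> \<Union> {subbasic K U | K U. compactin X K \<and> openin Y U}"
      by blast
  qed
  then show ?thesis
    unfolding \<rho>_def .
qed

lemma continuous_on_partial_roadmap:
  assumes "partial_roadmap C W F Q \<rho>"
  shows "continuous_on ({0..1} \<times> Q) (\<lambda>(t, q). \<rho> q t)"
    and "\<And>t q. t \<in> {0..1} \<Longrightarrow> q \<in> Q \<Longrightarrow> \<rho> q t \<in> C"
proof -
  have "neighbourhood_base_of (compactin (top_of_set {0..1::real})) (top_of_set {0..1})"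
    by (subst locally_compact_space_neighbourhood_base[symmetric])
      (auto intro!: compact_imp_locally_compact_space Hausdorff_space_subtopology
        simp: compact_space_subtopology)
  then have "continuous_map (prod_topology (top_of_set {0..1}) (top_of_set Q)) (top_of_set C)
      (\<lambda>(t, q). \<rho> q t)"
    using assms unfolding partial_roadmap_def path_space_def
    by (intro continuous_map_uncurry) auto
  then show "continuous_on ({0..1} \<times> Q) (\<lambda>(t, q). \<rho> q t)"
    and "\<And>t q. t \<in> {0..1} \<Longrightarrow> q \<in> Q \<Longrightarrow> \<rho> q t \<in> C"
    by (auto simp: Pi_iff)
qed

section \<open>Extension of roadmaps to open neighbourhoods\<close>

lemma locally_compact_preimage:
  fixes f :: "'a::euclidean_space \<Rightarrow> 'b::euclidean_space"
  assumes "locally compact S" "continuous_on S f" "locally compact T"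
  shows "locally compact (S \<inter> f -` T)"
proof -
  obtain K V where KV: "closed K" "open V" "T = K \<inter> V"
    using assms(3) unfolding locally_compact_closed_Int_open by blast
  have "locally compact (S \<inter> f -` K)"
    using assms KV by (meson continuous_closedin_preimage locally_compact_closedin)
  moreover have "locally compact (S \<inter> f -` V)"
    using assms KV by (meson continuous_openin_preimage_gen locally_open_subset)
  ultimately have "locally compact ((S \<inter> f -` K) \<inter> (S \<inter> f -` V))"
    by (rule locally_compact_Int)
  also have "(S \<inter> f -` K) \<inter> (S \<inter> f -` V) = S \<inter> f -` T"
    using KV by auto
  finally show ?thesis .
qed

lemma ENR_Times:
  fixes S :: "'a::euclidean_space set" and T :: "'b::euclidean_space set"
  assumes "ENR S" "ENR T"
  shows "ENR (S \<times> T)"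
proof -
  obtain U V where "open U" "S retract_of U" "open V" "T retract_of V"
    using assms unfolding ENR_def by blast
  then have "open (U \<times> V)" "(S \<times> T) retract_of (U \<times> V)"
    by (simp_all add: open_Times retract_of_Times)
  then show ?thesis
    unfolding ENR_def by blast
qed

text \<open>
  A locally compact set is closed in an open subset of the ambient space, which is exactly the
  situation in which a homotopy with values in an ANR extends to a neighbourhood. The extended
  homotopy ends at \<open>g\<close> of the second coordinate, and \<open>F\<close> sends this point to the required target
  because \<open>g\<close> is a section of \<open>F\<close>.
\<close>

lemma partial_roadmap_neighbourhood:
  fixes C :: "'a::euclidean_space set" and W :: "'b::euclidean_space set"
  assumes C: "ENR C" and W: "ENR W"
    and g: "continuous_on W g" "g ` W \<subseteq> C" "\<And>w. w \<in> W \<Longrightarrow> F (g w) = w"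
    and A: "A \<noteq> {}" "A \<subseteq> C \<times> W" "locally compact A"
    and hom: "homotopic_with_canon (\<lambda>_. True) A C fst (g \<circ> snd)"
  shows "\<exists>U \<rho>. A \<subseteq> U \<and> partial_roadmap C W F U \<rho>"
proof -
  obtain K V where KV: "closed K" "open V" "A = K \<inter> V"
    using A(3) unfolding locally_compact_closed_Int_open by blast
  define S where "S = (C \<times> W) \<inter> V"
  have "A = S \<inter> K"
    using A KV by (auto simp: S_def)
  then have A_closed: "closedin (top_of_set S) A"
    using KV(1) by (auto intro: closedin_closed_Int)
  have S_open: "openin (top_of_set (C \<times> W)) S"
    using KV(2) by (auto simp: S_def)
  have S_sub: "S \<subseteq> C \<times> W"
    by (auto simp: S_def)
  have "continuous_on S fst" "fst ` S \<subseteq> C"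
    using S_sub by (auto intro: continuous_intros)
  moreover have "continuous_on S (g \<circ> snd)"
    unfolding o_def
    by (rule continuous_on_compose2[OF g(1)]) (use S_sub in \<open>auto intro: continuous_intros\<close>)
  moreover have "(g \<circ> snd) ` S \<subseteq> C"
    using S_sub g(2) by force
  ultimately obtain U where U: "A \<subseteq> U" "openin (top_of_set S) U"
      "homotopic_with_canon (\<lambda>_. True) U C fst (g \<circ> snd)"
    using homotopic_neighbourhood_extension[OF _ _ _ _ A_closed ENR_imp_ANR[OF C] hom] by metis
  have "openin (top_of_set (C \<times> W)) U"
    using U(2) S_open by (rule openin_trans)
  then have U_ENR: "ENR U" and U_sub: "U \<subseteq> C \<times> W"
    using ENR_openin[OF ENR_Times[OF C W]] by (auto dest: openin_imp_subset)
  obtain h where h: "continuous_map (prod_topology (top_of_set {0..1}) (top_of_set U)) (top_of_set C) h"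
      "\<And>z. h (0::real, z) = fst z" "\<And>z. h (1, z) = (g \<circ> snd) z"
    using U(3) unfolding homotopic_with_def by blast
  define \<rho> where "\<rho> z = restrict (\<lambda>t. h (t, z)) {0..1}" for z
  have "continuous_map (top_of_set U) (path_space C) \<rho>"
    using continuous_map_curry[OF h(1)] unfolding path_space_def \<rho>_def by simp
  moreover have "\<rho> (c, w) 0 = c \<and> F (\<rho> (c, w) 1) = w" if "(c, w) \<in> U" for c w
    using that U_sub g(3) h(2,3) by (auto simp: \<rho>_def)
  ultimately have "partial_roadmap C W F U \<rho>"
    using U(1) A(1) U_ENR U_sub unfolding partial_roadmap_def by auto
  with U(1) show ?thesis
    by blast
qed

section \<open>Pullback of roadmap coverings\<close>

text \<open>
  The transport of coverings behind both inequalities. The pair \<open>(c, w)\<close> is sent to \<open>(a c, b w)\<close>,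
  a path is found there, and \<open>h\<close> carries it back to \<open>C\<close>; the hypothesis relating \<open>h\<close> and \<open>g\<close> says
  that the end point depends only on \<open>w\<close>, and continuously so, not on the path that was chosen.
\<close>

lemma roadmap_cover_pullback:
  fixes C :: "'a::euclidean_space set" and W :: "'b::euclidean_space set"
    and C' :: "'c::euclidean_space set" and W' :: "'d::euclidean_space set"
  assumes C: "ENR C" "C \<noteq> {}" and W: "ENR W" "W \<noteq> {}"
    and a: "continuous_on C a" "a ` C \<subseteq> C'"
    and b: "continuous_on W b" "b ` W \<subseteq> W'"
    and h: "continuous_on C' h" "h ` C' \<subseteq> C" "\<And>c. c \<in> C \<Longrightarrow> h (a c) = c"
    and g: "continuous_on W g" "g ` W \<subseteq> C" "\<And>w. w \<in> W \<Longrightarrow> F (g w) = w"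
    and hg: "\<And>p w. p \<in> C' \<Longrightarrow> w \<in> W \<Longrightarrow> F' p = b w \<Longrightarrow> h p = g w"
    and cover: "roadmap_cover C' W' F' n"
  shows "roadmap_cover C W F n"
proof -
  obtain Q \<rho> where Q: "\<And>i. i < n \<Longrightarrow> partial_roadmap C' W' F' (Q i) (\<rho> i)"
    and Q_cover: "C' \<times> W' = (\<Union>i<n. Q i)"
    using cover unfolding roadmap_cover_def by blast
  define \<phi> where "\<phi> z = (a (fst z), b (snd z))" for z
  define A where "A i = (C \<times> W) \<inter> \<phi> -` Q i" for i
  have \<phi>_cont: "continuous_on (C \<times> W) \<phi>"
    unfolding \<phi>_def
    by (intro continuous_on_Pair continuous_on_compose2[OF a(1)] continuous_on_compose2[OF b(1)]
        continuous_on_fst continuous_on_snd continuous_on_id) auto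
  have \<phi>_image: "\<phi> z \<in> C' \<times> W'" if "z \<in> C \<times> W" for z
    using a(2) b(2) that by (auto simp: \<phi>_def)
  have A_cover: "C \<times> W = (\<Union>i<n. A i)"
    using \<phi>_image unfolding Q_cover A_def by blast
  have nbhd: "\<exists>U \<sigma>. A i \<subseteq> U \<and> partial_roadmap C W F U \<sigma>" if i: "i < n" and ne: "A i \<noteq> {}" for i
  proof (rule partial_roadmap_neighbourhood[OF C(1) W(1) g ne])
    note Qi = Q[OF i]
    show "A i \<subseteq> C \<times> W"
      by (auto simp: A_def)
    show "locally compact (A i)"
      unfolding A_def using Qi C(1) W(1) \<phi>_cont
      by (intro locally_compact_preimage ENR_imp_locally_compact ENR_Times)
        (auto simp: partial_roadmap_def)
    let ?k = "\<lambda>p. h (\<rho> i (\<phi> (snd p)) (fst p))"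
    have path: "\<rho> i (\<phi> z) t \<in> C'" if "t \<in> {0..1}" "z \<in> A i" for t z
      using continuous_on_partial_roadmap(2)[OF Qi that(1)] that(2) by (auto simp: A_def)
    have "continuous_on ({0..1} \<times> A i) (\<lambda>p. (fst p, \<phi> (snd p)))"
      by (intro continuous_intros continuous_on_compose2[OF \<phi>_cont]) (auto simp: A_def)
    from continuous_on_compose2[OF continuous_on_partial_roadmap(1)[OF Qi] this]
    have "continuous_on ({0..1} \<times> A i) (\<lambda>p. \<rho> i (\<phi> (snd p)) (fst p))"
      by (force simp: A_def)
    from continuous_on_compose2[OF h(1) this] path
    have "continuous_on ({0..1} \<times> A i) ?k"
      by force
    moreover have "?k \<in> {0..1} \<times> A i \<rightarrow> C"
      using path h(2) by auto
    moreover have "?k (0, z) = fst z" "?k (1, z) = (g \<circ> snd) z" if z: "z \<in> A i" for z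
    proof -
      obtain c w where cw: "z = (c, w)" "c \<in> C" "w \<in> W" "(a c, b w) \<in> Q i"
        using z by (auto simp: A_def \<phi>_def)
      then have ends: "\<rho> i (a c, b w) 0 = a c" "F' (\<rho> i (a c, b w) 1) = b w"
        using Qi unfolding partial_roadmap_def by auto
      show "?k (0, z) = fst z"
        using ends cw h(3) by (simp add: \<phi>_def)
      show "?k (1, z) = (g \<circ> snd) z"
        using hg[OF path[OF _ z, of 1] cw(3)] ends cw by (simp add: \<phi>_def)
    qed
    ultimately show "homotopic_with_canon (\<lambda>_. True) (A i) C fst (g \<circ> snd)"
      by (subst homotopic_with) (auto intro!: exI[of _ ?k])
  qed
  \<comment> \<open>A preimage may be empty, whereas roadmap domains are nonempty; such an index reuses the
    neighbourhood of some nonempty preimage \<open>A j\<close>.\<close>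
  obtain j where j: "j < n" "A j \<noteq> {}"
    using A_cover C(2) W(2) by force
  have "\<exists>U \<sigma>. A i \<subseteq> U \<and> partial_roadmap C W F U \<sigma>" if "i < n" for i
    using nbhd[OF that] nbhd[OF j] by (cases "A i = {}") auto
  then obtain U \<sigma> where U: "\<And>i. i < n \<Longrightarrow> A i \<subseteq> U i \<and> partial_roadmap C W F (U i) (\<sigma> i)"
    by metis
  moreover have "C \<times> W = (\<Union>i<n. U i)"
  proof
    show "C \<times> W \<subseteq> (\<Union>i<n. U i)"
      using U A_cover by blast
    show "(\<Union>i<n. U i) \<subseteq> C \<times> W"
      using U unfolding partial_roadmap_def by blast
  qed
  ultimately show ?thesis
    unfolding roadmap_cover_def by blast
qed

lemma roadmap_cover_cx:
  assumes "has_cx C W F"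
  shows "roadmap_cover C W F (cx C W F)"
  using assms unfolding has_cx_def cx_def by (rule LeastI_ex)

lemma cx_le:
  assumes "roadmap_cover C W F n"
  shows "cx C W F \<le> n"
  using assms unfolding cx_def by (rule Least_le)

theorem theorem3p1:
  fixes C :: "'a::euclidean_space set"
    and W :: "'b::euclidean_space set"
    and F :: "'a \<Rightarrow> 'b"
  assumes "ENR C" and "C \<noteq> {}"
    and "ENR W" and "W \<noteq> {}"
    and "continuous_on C F" and "F ` C \<subseteq> W"
    and "\<exists>I. continuous_on W I \<and> I ` W \<subseteq> C \<and> (\<forall>w\<in>W. F (I w) = w)"
    and "has_cx_space W" and "has_cx C W F" and "has_cx_space C"
  shows "cx_space W \<le> cx C W F \<and> cx C W F \<le> cx_space C"
proof -
  obtain I where I: "continuous_on W I" "I ` W \<subseteq> C" "\<And>w. w \<in> W \<Longrightarrow> F (I w) = w"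
    using assms(7) by blast
  have "roadmap_cover W W id (cx C W F)"
    by (rule roadmap_cover_pullback[where a = I and b = id and h = F and g = id,
          OF _ _ _ _ _ _ _ _ _ _ _ _ _ _ _ roadmap_cover_cx[OF assms(9)]])
      (use assms I in auto)
  moreover have "roadmap_cover C W F (cx_space C)"
    by (rule roadmap_cover_pullback[where a = id and b = I and h = id and g = I,
          OF _ _ _ _ _ _ _ _ _ _ _ _ _ _ _ roadmap_cover_cx[OF assms(10)]])
      (use assms I in auto)
  ultimately show ?thesis
    by (simp add: cx_le)
qed

end
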